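(* Let $f(z,w)$ and $g(z,w)$ be polynomials in the $2n$ variables $z=(z_1,\ldots,z_n)$ and $w=(w_1,\ldots,w_n)$. If $f$ and $g$ are stable, then their Weyl product $(f\star g)(z,w)$ is also stable. If $f$ and $g$ are real stable, then $(f\star g)(z,w)$ is also real stable.
   Context: A polynomial with complex coefficients is stable if it is nonvanishing whenever all its variables have positive imaginary parts; it is real stable if in addition it has real coefficients. The Weyl product of $f(z,w),g(z,w)\in\mathbb{C}[z,w]$ is $$(f\star g)(z,w)=\sum_{\kappa\in\mathbb{N}^n}\frac{(-1)^{|\kappa|}}{\kappa!}\,\partial_z^\kappa f(z,w)\,\partial_w^\kappa g(z,w),$$ where $|\kappa|=\kappa_1+\cdots+\kappa_n$, $\kappa!=\kappa_1!\cdots\kappa_n!$, $\partial_z^\kappa=\prod_i(\partial/\partial z_i)^{\kappa_i}$ and $\partial_w^\kappa=\prod_i(\partial/\partial w_i)^{\kappa_i}$. *)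

theory Defs
  imports Complex_Main "HOL-Library.Poly_Mapping" "HOL-Library.FuncSet"
begin

text \<open>
  Polynomials over \<open>\<complex>\<close> in finitely many commuting variables indexed by the type \<open>'v\<close>:
  a finitely supported map from monomials (exponent vectors) to coefficients.
  Multiplication on this type is the convolution product of \<open>Poly_Mapping\<close>, that is,
  ordinary multiplication of polynomials.
\<close>

type_synonym 'v mpoly = "('v \<Rightarrow>\<^sub>0 nat) \<Rightarrow>\<^sub>0 complex"

definition mpoly_const :: "complex \<Rightarrow> 'v mpoly" where
  "mpoly_const c = Poly_Mapping.single 0 c"

definition mpoly_eval :: "'v::finite mpoly \<Rightarrow> ('v \<Rightarrow> complex) \<Rightarrow> complex" where
  "mpoly_eval p x =
     (\<Sum>m\<in>Poly_Mapping.keys p. Poly_Mapping.lookup p m * (\<Prod>v\<in>UNIV. x v ^ Poly_Mapping.lookup m v))"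

definition stable_poly :: "'v::finite mpoly \<Rightarrow> bool" where
  "stable_poly p \<longleftrightarrow> (\<forall>x. (\<forall>v. Im (x v) > 0) \<longrightarrow> mpoly_eval p x \<noteq> 0)"

definition real_stable_poly :: "'v::finite mpoly \<Rightarrow> bool" where
  "real_stable_poly p \<longleftrightarrow> stable_poly p \<and> (\<forall>m. Poly_Mapping.lookup p m \<in> \<real>)"

text \<open>
  The formal partial derivative \<open>\<partial>/\<partial>v\<close>. Where the exponent of \<open>v\<close> in \<open>m\<close> is \<open>0\<close>, the
  truncated subtraction is harmless, since the coefficient is then \<open>0\<close>.
\<close>

definition mpoly_pderiv :: "'v \<Rightarrow> 'v mpoly \<Rightarrow> 'v mpoly" where
  "mpoly_pderiv v p =
     (\<Sum>m\<in>Poly_Mapping.keys p.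
        Poly_Mapping.single (m - Poly_Mapping.single v 1)
          (of_nat (Poly_Mapping.lookup m v) * Poly_Mapping.lookup p m))"

text \<open>
  The iterated derivative \<open>\<Prod>\<^sub>i (\<partial>/\<partial>(e i))\<^bsup>\<kappa> i\<^esup>\<close> as a composition of operators, where \<open>e\<close> selects
  a block of variables. The order of composition is irrelevant because the partial derivatives
  commute (lemma \<open>mpoly_pderiv_funpow_commute\<close> below), so the fold is well defined.
\<close>

definition mpoly_pderivs :: "('n::finite \<Rightarrow> 'v) \<Rightarrow> ('n \<Rightarrow> nat) \<Rightarrow> 'v mpoly \<Rightarrow> 'v mpoly" where
  "mpoly_pderivs e \<kappa> p = Finite_Set.fold (\<lambda>i. mpoly_pderiv (e i) ^^ \<kappa> i) p UNIV"

text \<open>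
  The Weyl product. Variables are indexed by \<open>'n + 'n\<close>, where \<open>n\<close> is the cardinality of \<open>'n\<close>:
  \<open>Inl i\<close> is \<open>z\<^sub>i\<close> and \<open>Inr i\<close> is \<open>w\<^sub>i\<close>. The sum is \<open>Sum_any\<close>, which adds up the nonzero terms
  if there are finitely many; that this is so is lemma \<open>finite_weyl_term\<close> below.
\<close>

definition weyl_term ::
  "('n::finite + 'n) mpoly \<Rightarrow> ('n + 'n) mpoly \<Rightarrow> ('n \<Rightarrow> nat) \<Rightarrow> ('n + 'n) mpoly" where
  "weyl_term f g \<kappa> =
     mpoly_const ((-1) ^ (\<Sum>i\<in>UNIV. \<kappa> i) / (\<Prod>i\<in>UNIV. fact (\<kappa> i)))
       * mpoly_pderivs Inl \<kappa> f * mpoly_pderivs Inr \<kappa> g"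

definition weyl_product ::
  "('n::finite + 'n) mpoly \<Rightarrow> ('n + 'n) mpoly \<Rightarrow> ('n + 'n) mpoly" (infixl \<open>\<star>\<close> 70) where
  "f \<star> g = Sum_any (weyl_term f g)"

lemma lookup_mpoly_pderiv:
  "Poly_Mapping.lookup (mpoly_pderiv v p) m =
     of_nat (Poly_Mapping.lookup m v + 1) * Poly_Mapping.lookup p (m + Poly_Mapping.single v 1)"
proof -
  let ?e = "Poly_Mapping.single v (1::nat)"
  have key: "Poly_Mapping.lookup (Poly_Mapping.single (k - ?e)
        (of_nat (Poly_Mapping.lookup k v) * Poly_Mapping.lookup p k)) m
      = (if k = m + ?e then of_nat (Poly_Mapping.lookup k v) * Poly_Mapping.lookup p k else 0)" for k
  proof (cases "Poly_Mapping.lookup k v = 0")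
    case False
    have "k - ?e + ?e = k"
      by (rule poly_mapping_eqI)
        (use False in \<open>auto simp: lookup_add lookup_minus lookup_single when_def\<close>)
    then show ?thesis by (auto simp: lookup_single when_def)
  qed auto
  have "Poly_Mapping.lookup (mpoly_pderiv v p) m
      = (\<Sum>k\<in>Poly_Mapping.keys p. if k = m + ?e
          then of_nat (Poly_Mapping.lookup k v) * Poly_Mapping.lookup p k else 0)"
    unfolding mpoly_pderiv_def lookup_sum key ..
  also have "\<dots> = of_nat (Poly_Mapping.lookup (m + ?e) v) * Poly_Mapping.lookup p (m + ?e)"
    by (simp add: sum.delta in_keys_iff)
  finally show ?thesis by (simp add: lookup_add)
qed

lemma mpoly_pderiv_commute: "mpoly_pderiv u (mpoly_pderiv v p) = mpoly_pderiv v (mpoly_pderiv u p)"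
  by (rule poly_mapping_eqI, cases "u = v")
    (auto simp: lookup_mpoly_pderiv lookup_add lookup_single ac_simps)

lemma mpoly_pderiv_funpow_commute: "comp_fun_commute (\<lambda>i. mpoly_pderiv (e i) ^^ \<kappa> i)"
proof -
  interpret comp_fun_commute "\<lambda>i. mpoly_pderiv (e i)"
    by standard (auto simp: mpoly_pderiv_commute)
  show ?thesis by (rule comp_fun_commute_funpow)
qed

lemma mpoly_pderiv_funpow_zero: "(mpoly_pderiv v ^^ k) 0 = 0"
  by (induction k) (simp_all add: mpoly_pderiv_def)

lemma mpoly_pderiv_funpow_eq_0:
  assumes "\<And>m. m \<in> Poly_Mapping.keys p \<Longrightarrow> Poly_Mapping.lookup m v < k"
  shows "(mpoly_pderiv v ^^ k) p = 0"
  using assms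
proof (induction k arbitrary: p)
  case 0
  then have "Poly_Mapping.keys p = {}" using equals0I by fastforce
  then show ?case by simp
next
  case (Suc k)
  have "(mpoly_pderiv v ^^ k) (mpoly_pderiv v p) = 0"
  proof (rule Suc.IH)
    fix m assume "m \<in> Poly_Mapping.keys (mpoly_pderiv v p)"
    then have "m + Poly_Mapping.single v 1 \<in> Poly_Mapping.keys p"
      by (auto simp: in_keys_iff lookup_mpoly_pderiv)
    from Suc.prems[OF this] show "Poly_Mapping.lookup m v < k" by (simp add: lookup_add)
  qed
  then show ?case by (simp add: funpow_Suc_right del: funpow.simps)
qed

lemma mpoly_pderivs_eq_0:
  assumes "\<And>m. m \<in> Poly_Mapping.keys p \<Longrightarrow> Poly_Mapping.lookup m (e i) < \<kappa> i"
  shows "mpoly_pderivs e \<kappa> p = 0"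
proof -
  interpret comp_fun_commute "\<lambda>i. mpoly_pderiv (e i) ^^ \<kappa> i"
    by (rule mpoly_pderiv_funpow_commute)
  have zero: "Finite_Set.fold (\<lambda>i. mpoly_pderiv (e i) ^^ \<kappa> i) 0 A = 0" if "finite A" for A
    using that by (induction A) (simp_all add: mpoly_pderiv_funpow_zero)
  have "mpoly_pderivs e \<kappa> p
      = Finite_Set.fold (\<lambda>i. mpoly_pderiv (e i) ^^ \<kappa> i) p (insert i (UNIV - {i}))"
    by (simp add: mpoly_pderivs_def insert_UNIV insert_absorb)
  also have "\<dots> = Finite_Set.fold (\<lambda>i. mpoly_pderiv (e i) ^^ \<kappa> i)
      ((mpoly_pderiv (e i) ^^ \<kappa> i) p) (UNIV - {i})"
    by (rule fold_insert2) auto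
  also have "\<dots> = 0"
    by (simp add: mpoly_pderiv_funpow_eq_0[OF assms] zero)
  finally show ?thesis .
qed

lemma finite_weyl_term: "finite {\<kappa>. weyl_term f g \<kappa> \<noteq> 0}"
proof -
  define d where "d = (\<lambda>i. \<Sum>m\<in>Poly_Mapping.keys f. Poly_Mapping.lookup m (Inl i))"
  have "\<kappa> i \<le> d i" if "weyl_term f g \<kappa> \<noteq> 0" for \<kappa> i
  proof (rule ccontr)
    assume "\<not> \<kappa> i \<le> d i"
    moreover have "Poly_Mapping.lookup m (Inl i) \<le> d i" if "m \<in> Poly_Mapping.keys f" for m
      unfolding d_def using that by (intro member_le_sum) auto
    ultimately have "mpoly_pderivs Inl \<kappa> f = 0"
      by (intro mpoly_pderivs_eq_0[where i = i]) (meson le_less_trans not_le)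
    with that show False by (simp add: weyl_term_def)
  qed
  then have "{\<kappa>. weyl_term f g \<kappa> \<noteq> 0} \<subseteq> Pi\<^sub>E UNIV (\<lambda>i. {..d i})"
    by (auto simp: PiE_def)
  then show ?thesis by (rule finite_subset) (auto intro!: finite_PiE)
qed

end

theory Submission
  imports Defs "HOL-Computational_Algebra.Fundamental_Theorem_Algebra"
begin

text \<open>
  At a point \<open>(x, y)\<close> the Weyl product is \<open>exp (- \<Sum>\<^sub>i \<partial>\<^sub>s\<^sub>i \<partial>\<^sub>t\<^sub>i)\<close> applied to \<open>f(s, y) g(x, t)\<close>, taken at
  \<open>s = x\<close>, \<open>t = y\<close>. The factors \<open>exp (- \<partial>\<^sub>s\<^sub>i \<partial>\<^sub>t\<^sub>i)\<close> are applied one at a time, with all other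
  variables frozen in the upper half-plane, so it suffices that \<open>exp (- D)\<close>, \<open>D = \<partial>\<^sub>s \<partial>\<^sub>t\<close>, preserves
  stability of polynomials \<open>F(s, t)\<close> in two variables.

  Write \<open>exp (- D)\<close> as the limit of \<open>(1 - D / N)\<^sup>N\<close>. If \<open>F\<close> is stable of degree at most \<open>d\<close> in each
  variable, then \<open>F\<^sub>s / F\<close> and, where defined, \<open>F\<^sub>s\<^sub>t / F\<^sub>s\<close> have nonpositive imaginary part, which makes
  \<open>F - c D F\<close> stable for \<open>c > 0\<close>; moreover \<open>|D F| \<le> K |F|\<close> with \<open>K = d\<^sup>2 / (Im s Im t)\<close>. The constant
  \<open>K\<close> is the same for every iterate, hence \<open>|(1 - D / N)\<^sup>N F| \<ge> (1 - K / N)\<^sup>N |F|\<close>, and the limit is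
  bounded below by \<open>exp (- K) |F| > 0\<close>.
\<close>

section \<open>Logarithmic derivatives in one variable\<close>

text \<open>The quotient is \<Sum> 1 / (a - \<xi>) over the roots \<xi> of \<open>p\<close> with
  multiplicity. As Im \<xi> \<le> 0, each summand has norm at most \<open>1 / Im a\<close> and
  negative imaginary part. The induction removes one root at a time.\<close>

lemma log_deriv_upper_half_plane:
  fixes p :: "complex poly"
  assumes "\<And>s. Im s > 0 \<Longrightarrow> poly p s \<noteq> 0" "Im a > 0"
  shows "norm (poly (pderiv p) a / poly p a) \<le> degree p / Im a"
    and "Im (poly (pderiv p) a / poly p a) \<le> 0"
    and "poly (pderiv p) a \<noteq> 0 \<Longrightarrow> Im (poly (pderiv p) a / poly p a) < 0"
proof -
  have "norm (poly (pderiv p) a / poly p a) \<le> degree p / Im a \<and>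
      (if degree p = 0 then pderiv p = 0 else Im (poly (pderiv p) a / poly p a) < 0)"
    using assms
  proof (induction "degree p" arbitrary: p)
    case 0
    then have "pderiv p = 0" by (simp add: pderiv_eq_0_iff)
    with 0 show ?case by simp
  next
    case (Suc n)
    then have "\<not> constant (poly p)" by (simp add: constant_degree)
    then obtain \<xi> where "poly p \<xi> = 0"
      using fundamental_theorem_of_algebra by blast
    then obtain q where p: "p = [:-\<xi>, 1:] * q"
      by (auto simp: poly_eq_0_iff_dvd)
    have \<xi>: "Im \<xi> \<le> 0"
      using \<open>poly p \<xi> = 0\<close> Suc.prems(1) not_le by blast
    have "q \<noteq> 0" using p Suc.hyps by auto
    then have deg: "degree p = Suc (degree q)"
      unfolding p by (subst degree_mult_eq) auto
    have qnz: "poly q s \<noteq> 0" if "Im s > 0" for s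
      using Suc.prems(1)[OF that] by (auto simp: p)
    have IH: "norm (poly (pderiv q) a / poly q a) \<le> degree q / Im a"
      "if degree q = 0 then pderiv q = 0 else Im (poly (pderiv q) a / poly q a) < 0"
      using Suc.hyps(1)[of q] Suc.hyps(2) deg qnz Suc.prems(2) by auto
    have IH2: "Im (poly (pderiv q) a / poly q a) \<le> 0"
      using IH(2) by (auto split: if_splits)
    have pos: "Im (a - \<xi>) > 0" "Im (a - \<xi>) \<ge> Im a" using Suc.prems(2) \<xi> by auto
    then have nz: "a - \<xi> \<noteq> 0" by auto
    have "poly (pderiv p) a = poly q a + (a - \<xi>) * poly (pderiv q) a"
      unfolding p pderiv_mult by (simp add: pderiv_pCons algebra_simps)
    then have eq: "poly (pderiv p) a / poly p a = 1 / (a - \<xi>) + poly (pderiv q) a / poly q a"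
      using nz qnz[OF Suc.prems(2)] by (simp add: p field_simps)
    have "Im a \<le> norm (a - \<xi>)"
      using abs_Im_le_cmod[of "a - \<xi>"] pos by linarith
    then have "norm (1 / (a - \<xi>)) \<le> 1 / Im a"
      using Suc.prems(2) by (simp add: norm_divide frac_le)
    then have "norm (poly (pderiv p) a / poly p a) \<le> 1 / Im a + degree q / Im a"
      unfolding eq using IH(1) by (intro order.trans[OF norm_triangle_ineq] add_mono)
    moreover have "Im (1 / (a - \<xi>)) < 0"
      using pos nz by (simp add: Im_divide divide_neg_pos sum_power2_gt_zero_iff complex_eq_iff)
    ultimately show ?case
      using IH2 by (simp add: eq deg add_divide_distrib del: plus_complex.sel Im_divide) 
        (simp add: plus_complex.sel)
  qed
  then show "norm (poly (pderiv p) a / poly p a) \<le> degree p / Im a"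
    and "Im (poly (pderiv p) a / poly p a) \<le> 0"
    and "poly (pderiv p) a \<noteq> 0 \<Longrightarrow> Im (poly (pderiv p) a / poly p a) < 0"
    by (auto split: if_splits)
qed

section \<open>The operators \<open>D\<close> and \<open>1 - c D\<close> on two-variable
  polynomials\<close>

text \<open>A list of pairs \<open>(P, Q)\<close> stands for the two-variable polynomial \<open>\<Sum> P(s) Q(t)\<close>.\<close>

definition tensor_eval :: "(complex poly \<times> complex poly) list \<Rightarrow> complex \<Rightarrow> complex \<Rightarrow> complex" where
  "tensor_eval L s t = (\<Sum>(P, Q)\<leftarrow>L. poly P s * poly Q t)"

definition tensor_deriv ::
  "(complex poly \<times> complex poly) list \<Rightarrow> (complex poly \<times> complex poly) list" where
  "tensor_deriv = map (\<lambda>(P, Q). (pderiv P, pderiv Q))"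

text \<open>The operator \<open>1 - c D\<close>: addition is concatenation, and the scalar is
  absorbed into the first factors.\<close>

definition tensor_step ::
  "complex \<Rightarrow> (complex poly \<times> complex poly) list \<Rightarrow> (complex poly \<times> complex poly) list" where
  "tensor_step c L = L @ map (\<lambda>(P, Q). (smult (-c) P, Q)) (tensor_deriv L)"

definition tensor_degree_le :: "nat \<Rightarrow> (complex poly \<times> complex poly) list \<Rightarrow> bool" where
  "tensor_degree_le d L \<longleftrightarrow> (\<forall>(P, Q) \<in> set L. degree P \<le> d \<and> degree Q \<le> d)"

definition tensor_stable :: "(complex poly \<times> complex poly) list \<Rightarrow> bool" where
  "tensor_stable L \<longleftrightarrow> (\<forall>s t. Im s > 0 \<longrightarrow> Im t > 0 \<longrightarrow> tensor_eval L s t \<noteq> 0)"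

lemma tensor_eval_step:
  "tensor_eval (tensor_step c L) s t = tensor_eval L s t - c * tensor_eval (tensor_deriv L) s t"
  by (induction L)
    (auto simp: tensor_eval_def tensor_step_def tensor_deriv_def algebra_simps split: prod.splits)

lemma tensor_deriv_step: "tensor_deriv (tensor_step c L) = tensor_step c (tensor_deriv L)"
  by (auto simp: tensor_step_def tensor_deriv_def pderiv_smult pderiv_minus)

lemma tensor_deriv_funpow_step:
  "(tensor_deriv ^^ k) (tensor_step c L) = tensor_step c ((tensor_deriv ^^ k) L)"
  by (induction k) (auto simp: tensor_deriv_step)

lemma tensor_degree_le_deriv: "tensor_degree_le d L \<Longrightarrow> tensor_degree_le d (tensor_deriv L)"
  by (fastforce simp: tensor_degree_le_def tensor_deriv_def degree_pderiv)

lemma tensor_degree_le_step: "tensor_degree_le d L \<Longrightarrow> tensor_degree_le d (tensor_step c L)"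
  using tensor_degree_le_deriv[of d L] by (fastforce simp: tensor_degree_le_def tensor_step_def)

text \<open>The binomial theorem for \<open>(1 - c D)^N\<close>, available because \<open>D\<close>
  commutes with \<open>1 - c D\<close>.\<close>

lemma tensor_eval_funpow_step:
  "tensor_eval ((tensor_step c ^^ N) L) s t =
     (\<Sum>k\<le>N. of_nat (N choose k) * (-c) ^ k * tensor_eval ((tensor_deriv ^^ k) L) s t)"
proof (induction N arbitrary: L)
  case 0
  then show ?case by simp
next
  case (Suc N)
  define e where "e k = tensor_eval ((tensor_deriv ^^ k) L) s t" for k
  have step: "tensor_eval ((tensor_deriv ^^ k) (tensor_step c L)) s t = e k - c * e (Suc k)" for k
    by (simp add: tensor_deriv_funpow_step tensor_eval_step e_def)
  have "tensor_eval ((tensor_step c ^^ Suc N) L) s t =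
      (\<Sum>k\<le>N. of_nat (N choose k) * (-c) ^ k * (e k - c * e (Suc k)))"
    by (simp add: funpow_Suc_right Suc.IH step del: funpow.simps)
  also have "\<dots> = (\<Sum>k\<le>N. of_nat (N choose k) * (-c) ^ k * e k) +
      (\<Sum>k\<le>N. of_nat (N choose k) * (-c) ^ Suc k * e (Suc k))"
    by (simp add: sum.distrib [symmetric] algebra_simps)
  \<comment> \<open>The added term is zero as \<open>N choose Suc N = 0\<close>. After the index
    shift, Pascal's rule merges the two sums.\<close>
  also have "(\<Sum>k\<le>N. of_nat (N choose k) * (-c) ^ k * e k) =
      (\<Sum>k\<le>Suc N. of_nat (N choose k) * (-c) ^ k * e k)"
    by simp
  also have "\<dots> = e 0 + (\<Sum>k\<le>N. of_nat (N choose Suc k) * (-c) ^ Suc k * e (Suc k))"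
    by (subst sum.atMost_Suc_shift) simp
  also have "\<dots> + (\<Sum>k\<le>N. of_nat (N choose k) * (-c) ^ Suc k * e (Suc k)) =
      e 0 + (\<Sum>k\<le>N. of_nat (Suc N choose Suc k) * (-c) ^ Suc k * e (Suc k))"
    by (simp add: sum.distrib [symmetric] algebra_simps)
  also have "\<dots> = (\<Sum>k\<le>Suc N. of_nat (Suc N choose k) * (-c) ^ k * e k)"
    by (subst sum.atMost_Suc_shift) simp
  finally show ?case by (simp add: e_def)
qed

lemma tensor_eval_funpow_deriv_eq_0:
  assumes "tensor_degree_le d L" "k > d"
  shows "tensor_eval ((tensor_deriv ^^ k) L) s t = 0"
proof -
  have eq: "(tensor_deriv ^^ k) L = map (\<lambda>(P, Q). ((pderiv ^^ k) P, (pderiv ^^ k) Q)) L"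
    by (induction k) (auto simp: tensor_deriv_def)
  have "(pderiv ^^ k) P = 0" if "(P, Q) \<in> set L" for P Q
  proof (rule poly_eqI)
    fix n
    have "degree P \<le> d" using assms that by (auto simp: tensor_degree_le_def)
    then show "coeff ((pderiv ^^ k) P) n = coeff 0 n"
      using assms(2) by (simp add: coeff_higher_pderiv coeff_eq_0)
  qed
  then have "tensor_eval ((tensor_deriv ^^ k) L) s t = (\<Sum>x\<leftarrow>L. 0)"
    unfolding eq tensor_eval_def map_map by (intro arg_cong[where f = sum_list] map_cong) auto
  then show ?thesis by simp
qed

section \<open>Estimates for a single step\<close>

text \<open>The one-variable estimates are used twice: in \<open>s\<close> for F_s / F, then in
  \<open>t\<close> for F_st / F_s. The two norm bounds multiply to the constant, and the two signs
  exclude a zero of \<open>F - c * E\<close>.\<close>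

lemma tensor_deriv_bound:
  fixes c :: real
  assumes "tensor_stable L" "tensor_degree_le d L" "Im a > 0" "Im b > 0"
  defines "F \<equiv> tensor_eval L a b" and "E \<equiv> tensor_eval (tensor_deriv L) a b"
  shows "norm E \<le> real d ^ 2 / (Im a * Im b) * norm F"
    and "c > 0 \<Longrightarrow> F - of_real c * E \<noteq> 0"
proof -
  \<comment> \<open>\<open>Pa t\<close> is F(., t) as a polynomial in \<open>s\<close>,
    \<open>A t\<close> is F_s(a, t), and \<open>B\<close> is F_t(a, b).\<close>
  define Pa where "Pa t = (\<Sum>(P, Q)\<leftarrow>L. smult (poly Q t) P)" for t
  define A where "A t = (\<Sum>(P, Q)\<leftarrow>L. poly (pderiv P) a * poly Q t)" for t
  define B where "B = (\<Sum>(P, Q)\<leftarrow>L. poly P a * poly (pderiv Q) b)"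
  have degPa: "degree (Pa t) \<le> d" for t
    using assms(2) unfolding Pa_def tensor_degree_le_def
    by (induction L) (auto intro: degree_add_le order.trans[OF degree_smult_le])
  have Pa: "poly (Pa t) s = tensor_eval L s t" for s t
    unfolding Pa_def tensor_eval_def by (induction L) (auto simp: mult_ac)
  have Pa': "poly (pderiv (Pa t)) a = A t" for t
    unfolding Pa_def A_def by (induction L) (auto simp: pderiv_add pderiv_smult mult_ac)
  have Pa_nz: "poly (Pa t) s \<noteq> 0" if "Im s > 0" "Im t > 0" for s t
    using assms(1) that by (simp add: Pa tensor_stable_def)
  have Fnz: "tensor_eval L a t \<noteq> 0" if "Im t > 0" for t
    using Pa_nz that assms(3) by (simp add: Pa)
  have A_norm: "norm (A b / F) \<le> d / Im a"
    using log_deriv_upper_half_plane(1)[OF Pa_nz \<open>Im a > 0\<close>] degPa[of b] assms(3,4)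
    unfolding Pa Pa' F_def
    by (meson divide_right_mono less_imp_le of_nat_le_iff order.trans)
  have A_le: "Im (A t / tensor_eval L a t) \<le> 0" if "Im t > 0" for t
    using log_deriv_upper_half_plane(2)[OF Pa_nz[OF _ that] \<open>Im a > 0\<close>] by (simp add: Pa Pa')
  have A_less: "Im (A b / F) < 0" if "A b \<noteq> 0"
    using log_deriv_upper_half_plane(3)[OF Pa_nz[OF _ assms(4)] \<open>Im a > 0\<close>] that
    by (simp add: Pa Pa' F_def)
  \<comment> \<open>\<open>A t\<close> itself may vanish, but for \<open>Im u > 0\<close> the polynomial \<open>A - u F\<close> in \<open>t\<close> is zero-free on
    the upper half-plane; \<open>u \<rightarrow> 0\<close> transfers its estimates to \<open>A\<close>.\<close>
  have key: "norm (E - u * B) \<le> d / Im b * norm (A b - u * F)"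
    "Im ((E - u * B) * cnj (A b - u * F)) \<le> 0" if u: "Im u > 0" for u
  proof -
    define R where "R = (\<Sum>(P, Q)\<leftarrow>L. smult (poly (pderiv P) a - u * poly P a) Q)"
    have R: "poly R t = A t - u * tensor_eval L a t" for t
      unfolding R_def A_def tensor_eval_def by (induction L) (auto simp: algebra_simps)
    have R': "poly (pderiv R) b = E - u * B"
      unfolding R_def E_def B_def tensor_eval_def tensor_deriv_def
      by (induction L) (auto simp: pderiv_add pderiv_smult algebra_simps)
    have degR: "degree R \<le> d"
      using assms(2) unfolding R_def tensor_degree_le_def
      by (induction L) (auto intro: degree_add_le order.trans[OF degree_smult_le])
    have Rnz: "poly R t \<noteq> 0" if "Im t > 0" for t
    proof
      assume "poly R t = 0"
      then have "A t / tensor_eval L a t = u"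
        using Fnz[OF that] by (simp add: R field_simps)
      then show False using A_le[OF that] u by simp
    qed
    have Rb: "A b - u * F \<noteq> 0" using Rnz[OF assms(4)] by (simp add: R F_def)
    have "norm ((E - u * B) / (A b - u * F)) \<le> d / Im b"
      using log_deriv_upper_half_plane(1)[OF Rnz \<open>Im b > 0\<close>] degR assms(4)
      unfolding R R' F_def
      by (meson divide_right_mono less_imp_le of_nat_le_iff order.trans)
    then show "norm (E - u * B) \<le> d / Im b * norm (A b - u * F)"
      using Rb by (simp add: norm_divide divide_le_eq)
    have "Im ((E - u * B) / (A b - u * F)) \<le> 0"
      using log_deriv_upper_half_plane(2)[OF Rnz \<open>Im b > 0\<close>] by (simp add: R R' F_def)
    \<comment> \<open>In this form, without a quotient, the sign survives the limit
      \<open>u -> 0\<close> even if \<open>A b = 0\<close>.\<close>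
    then have "Im ((E - u * B) * cnj (A b - u * F)) / (norm (A b - u * F))\<^sup>2 \<le> 0"
      by (subst (asm) complex_div_cnj) simp
    then show "Im ((E - u * B) * cnj (A b - u * F)) \<le> 0"
      using Rb by (simp add: divide_le_0_iff)
  qed
  define u where "u n = \<i> * complex_of_real (inverse (real (Suc n)))" for n
  have u: "u \<longlonglongrightarrow> \<i> * complex_of_real 0"
    unfolding u_def by (intro tendsto_intros LIMSEQ_inverse_real_of_nat)
  have u_pos: "Im (u n) > 0" for n by (simp add: u_def)
  have lim: "(\<lambda>n. E - u n * B) \<longlonglongrightarrow> E" "(\<lambda>n. A b - u n * F) \<longlonglongrightarrow> A b"
    using tendsto_diff[OF tendsto_const tendsto_mult_right[OF u]] by simp_all
  have E_norm: "norm E \<le> d / Im b * norm (A b)"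
    by (rule LIMSEQ_le[OF tendsto_norm[OF lim(1)] tendsto_mult_left[OF tendsto_norm[OF lim(2)]]])
      (use key(1)[OF u_pos] in blast)
  have E_Im: "Im (E * cnj (A b)) \<le> 0"
    by (rule LIMSEQ_le_const2[OF tendsto_Im[OF tendsto_mult[OF lim(1) tendsto_cnj[OF lim(2)]]]])
      (use key(2)[OF u_pos] in blast)
  have F: "F \<noteq> 0" using Fnz assms(4) by (simp add: F_def)
  have "norm (A b) \<le> d / Im a * norm F"
    using A_norm F by (simp add: norm_divide divide_le_eq)
  then have "d / Im b * norm (A b) \<le> d / Im b * (d / Im a * norm F)"
    using assms(4) by (intro mult_left_mono) auto
  with E_norm show "norm E \<le> real d ^ 2 / (Im a * Im b) * norm F"
    by (simp add: power2_eq_square mult_ac)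
  show "F - of_real c * E \<noteq> 0" if "c > 0"
  proof (cases "A b = 0")
    \<comment> \<open>Here \<open>E_norm\<close> forces \<open>E = 0\<close>.\<close>
    case True
    then show ?thesis using E_norm F by simp
  next
    case False
    \<comment> \<open>After multiplication by \<open>cnj (A b)\<close>, the term from
      \<open>F\<close> has positive imaginary part and the one from \<open>- c * E\<close>
      nonnegative imaginary part, so they cannot cancel.\<close>
    have "Im (A b * cnj F) / (norm F)\<^sup>2 < 0"
      using A_less[OF False] by (subst (asm) complex_div_cnj) simp
    then have "Im (F * cnj (A b)) > 0"
      using F by (simp add: divide_less_0_iff algebra_simps)
    moreover have "c * Im (E * cnj (A b)) \<le> 0"
      using E_Im that by (simp add: mult_nonneg_nonpos)
    moreover have "Im ((F - of_real c * E) * cnj (A b)) = Im (F * cnj (A b)) - c * Im (E * cnj (A b))"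
      by (simp add: algebra_simps)
    ultimately have "Im ((F - of_real c * E) * cnj (A b)) > 0" by linarith
    then show ?thesis by auto
  qed
qed

lemma tensor_stable_step:
  assumes "tensor_stable L" "c > 0"
  shows "tensor_stable (tensor_step (of_real c) L)"
proof -
  obtain d where "tensor_degree_le d L"
  proof
    show "tensor_degree_le (\<Sum>(P, Q)\<leftarrow>L. degree P + degree Q) L"
      unfolding tensor_degree_le_def by (induction L) fastforce+
  qed
  with assms show ?thesis
    unfolding tensor_stable_def[of "tensor_step _ _"]
    by (auto simp: tensor_eval_step dest: tensor_deriv_bound(2))
qed

section \<open>Passage to the limit \<open>exp (- D)\<close>\<close>

text \<open>These are the coefficients of \<open>(1 - D / n)^n\<close> up to sign. Successive ones
  have ratio \<open>(1 - k / n) / (k + 1)\<close>, which tends to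
  \<open>1 / (k + 1)\<close>.\<close>

lemma choose_over_power_tendsto:
  "(\<lambda>n. real (n choose k) / real n ^ k) \<longlonglongrightarrow> 1 / fact k"
proof (induction k)
  case 0
  then show ?case by simp
next
  case (Suc k)
  have lim: "(\<lambda>n. real (n choose k) / real n ^ k * ((1 - real k * (1 / real n)) / real (Suc k)))
      \<longlonglongrightarrow> 1 / fact k * ((1 - real k * 0) / real (Suc k))"
    by (intro tendsto_intros Suc.IH lim_1_over_n) simp
  have "eventually (\<lambda>n. real (n choose k) / real n ^ k * ((1 - real k * (1 / real n)) / real (Suc k)) =
      real (n choose Suc k) / real n ^ Suc k) sequentially"
    using eventually_gt_at_top[of k]
  proof eventually_elim
    case (elim n)
    have "Suc k * (n choose Suc k) = (n choose k) * (n - k)"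
      using binomial_absorb_comp[of n k] binomial_absorption[of k n] by (simp add: mult_ac)
    then have "real (Suc k) * real (n choose Suc k) = real (n choose k) * (real n - real k)"
      using elim by (metis of_nat_mult of_nat_diff less_imp_le)
    then have *: "real (n choose Suc k) = real (n choose k) * (real n - real k) / real (Suc k)"
      by (simp add: field_simps)
    show ?case unfolding * using elim by (simp add: field_simps)
  qed
  from Lim_transform_eventually[OF lim this] show ?case by (simp add: mult_ac)
qed

text \<open>The sum is all of \<open>exp (- D) F\<close>, since higher powers of \<open>D\<close>
  annihilate \<open>F\<close>. A limit of nonzero values may vanish, so a lower bound uniform in
  \<open>n\<close> is carried along.\<close>

lemma tensor_exp_nonzero:
  assumes "tensor_stable L" "tensor_degree_le d L" "Im a > 0" "Im b > 0"
  shows "(\<Sum>k\<le>d. (-1) ^ k / fact k * tensor_eval ((tensor_deriv ^^ k) L) a b) \<noteq> 0"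
proof -
  define K where "K = real d ^ 2 / (Im a * Im b)"
  define e where "e k = tensor_eval ((tensor_deriv ^^ k) L) a b" for k
  define U where "U n = tensor_eval ((tensor_step (of_real (1 / real n)) ^^ n) L) a b" for n
  have "K \<ge> 0" using assms(3,4) by (simp add: K_def)
  \<comment> \<open>Stability and the degree bound belong to the invariant because they give every
    iterate the same \<open>K\<close>. The condition \<open>c * K \<le> 1\<close> keeps the factor
    \<open>1 - c * K\<close> nonnegative.\<close>
  have inv: "tensor_stable ((tensor_step (of_real c) ^^ N) L) \<and>
      tensor_degree_le d ((tensor_step (of_real c) ^^ N) L) \<and>
      norm (tensor_eval ((tensor_step (of_real c) ^^ N) L) a b) \<ge> (1 - c * K) ^ N * norm (e 0)"
    if c: "c > 0" "c * K \<le> 1" for c N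
  proof (induction N)
    case 0
    then show ?case using assms by (simp add: e_def)
  next
    case (Suc N)
    define M where "M = (tensor_step (of_real c) ^^ N) L"
    have "norm (tensor_eval (tensor_deriv M) a b) \<le> K * norm (tensor_eval M a b)"
      using tensor_deriv_bound(1)[of M d a b] Suc assms(3,4) by (simp add: K_def M_def)
    then have "c * norm (tensor_eval (tensor_deriv M) a b) \<le> c * (K * norm (tensor_eval M a b))"
      using c by simp
    moreover have "norm (tensor_eval (tensor_step (of_real c) M) a b) \<ge>
        norm (tensor_eval M a b) - c * norm (tensor_eval (tensor_deriv M) a b)"
      using norm_triangle_ineq2[of "tensor_eval M a b" "of_real c * tensor_eval (tensor_deriv M) a b"] c
      by (simp add: tensor_eval_step norm_mult)
    ultimately have "norm (tensor_eval (tensor_step (of_real c) M) a b) \<ge>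
        (1 - c * K) * norm (tensor_eval M a b)"
      by (simp add: algebra_simps)
    moreover have "(1 - c * K) * norm (tensor_eval M a b) \<ge> (1 - c * K) * ((1 - c * K) ^ N * norm (e 0))"
      using Suc c by (intro mult_left_mono) (auto simp: M_def)
    ultimately show ?case
      using Suc c tensor_stable_step tensor_degree_le_step by (auto simp: M_def mult_ac)
  qed
  \<comment> \<open>The range becomes independent of \<open>n\<close>: binomial coefficients vanish
    for \<open>k > n\<close>, derivatives for \<open>k > d\<close>.\<close>
  have U: "U n = (\<Sum>k\<le>d. (-1) ^ k * of_real (real (n choose k) / real n ^ k) * e k)" for n
  proof -
    have "U n = (\<Sum>k\<le>n. (-1) ^ k * of_real (real (n choose k) / real n ^ k) * e k)"
      unfolding U_def tensor_eval_funpow_step e_def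
      by (intro sum.cong refl) (simp add: power_minus[of "_ / _"] power_minus[of "inverse _"] power_divide mult_ac)
    also have "\<dots> = (\<Sum>k\<le>max n d. (-1) ^ k * of_real (real (n choose k) / real n ^ k) * e k)"
      by (rule sum.mono_neutral_left) (auto simp: binomial_eq_0)
    also have "\<dots> = (\<Sum>k\<le>d. (-1) ^ k * of_real (real (n choose k) / real n ^ k) * e k)"
      by (rule sum.mono_neutral_right) (auto simp: e_def tensor_eval_funpow_deriv_eq_0[OF assms(2)])
    finally show ?thesis .
  qed
  have lim: "U \<longlonglongrightarrow> (\<Sum>k\<le>d. (-1) ^ k * of_real (1 / fact k) * e k)"
    unfolding U by (intro tendsto_intros choose_over_power_tendsto)
  have "exp (-K) * norm (e 0) \<le> norm (\<Sum>k\<le>d. (-1) ^ k * complex_of_real (1 / fact k) * e k)"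
  proof (rule tendsto_le[OF sequentially_bot tendsto_norm[OF lim] tendsto_mult[OF tendsto_exp_limit_sequentially tendsto_const]])
    show "eventually (\<lambda>n. (1 + - K / real n) ^ n * norm (e 0) \<le> norm (U n)) sequentially"
      \<comment> \<open>From this threshold on, \<open>c = 1 / n\<close> is positive and satisfies
        \<open>c * K \<le> 1\<close>.\<close>
      using eventually_ge_at_top[of "nat \<lceil>K\<rceil> + 1"]
    proof eventually_elim
      case (elim n)
      then have "K \<le> n" "n > 0" by linarith+
      then show ?case using inv[of "1 / n" n] by (simp add: U_def)
    qed
  qed
  moreover have "e 0 \<noteq> 0" using assms by (simp add: e_def tensor_stable_def)
  ultimately have "(\<Sum>k\<le>d. (-1) ^ k * complex_of_real (1 / fact k) * e k) \<noteq> 0"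
    by (auto simp: mult_le_0_iff)
  then show ?thesis by (simp add: e_def)
qed

section \<open>Evaluation, one-variable sections and degrees\<close>

text \<open>Cancellation can shrink the support of a sum, so additivity is proved over a common
  larger set of monomials.\<close>

lemma mpoly_eval_superset:
  assumes "finite K" "Poly_Mapping.keys p \<subseteq> K"
  shows "mpoly_eval p x =
    (\<Sum>m\<in>K. Poly_Mapping.lookup p m * (\<Prod>v\<in>UNIV. x v ^ Poly_Mapping.lookup m v))"
  unfolding mpoly_eval_def using assms by (intro sum.mono_neutral_left) (auto simp: in_keys_iff)

lemma mpoly_eval_0 [simp]: "mpoly_eval 0 x = 0"
  by (simp add: mpoly_eval_def)

lemma mpoly_eval_add: "mpoly_eval (p + q) x = mpoly_eval p x + mpoly_eval q x"
proof -
  let ?K = "Poly_Mapping.keys p \<union> Poly_Mapping.keys q"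
  have "Poly_Mapping.keys (p + q) \<subseteq> ?K" by (rule Poly_Mapping.keys_add)
  then show ?thesis
    by (subst (1 2 3) mpoly_eval_superset[of ?K])
      (auto simp: lookup_add ring_distribs sum.distrib)
qed

lemma mpoly_eval_sum: "mpoly_eval (\<Sum>i\<in>I. p i) x = (\<Sum>i\<in>I. mpoly_eval (p i) x)"
  by (induction I rule: infinite_finite_induct) (auto simp: mpoly_eval_add)

lemma mpoly_eval_single:
  "mpoly_eval (Poly_Mapping.single m c) x = c * (\<Prod>v\<in>UNIV. x v ^ Poly_Mapping.lookup m v)"
  by (simp add: mpoly_eval_def)

lemma mpoly_eval_const: "mpoly_eval (mpoly_const c) x = c"
  by (simp add: mpoly_const_def mpoly_eval_single)

lemma poly_mapping_eq_sum_single: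
  "p = (\<Sum>m\<in>Poly_Mapping.keys p. Poly_Mapping.single m (Poly_Mapping.lookup p m))"
  by (rule poly_mapping_eqI) (simp add: lookup_sum lookup_single when_def sum.delta in_keys_iff)

lemma poly_mapping_mult_eq_sum_single:
  "p * q = (\<Sum>m\<in>Poly_Mapping.keys p. \<Sum>k\<in>Poly_Mapping.keys q.
     Poly_Mapping.single (m + k) (Poly_Mapping.lookup p m * Poly_Mapping.lookup q k))"
  by (subst poly_mapping_eq_sum_single[of p], subst poly_mapping_eq_sum_single[of q])
    (simp add: sum_product mult_single)

lemma mpoly_eval_mult: "mpoly_eval (p * q) x = mpoly_eval p x * mpoly_eval q x"
  by (simp add: poly_mapping_mult_eq_sum_single mpoly_eval_sum mpoly_eval_single lookup_add
      power_add prod.distrib mpoly_eval_def[of p] mpoly_eval_def[of q] sum_product mult_ac)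

text \<open>The restriction of \<open>p\<close> to the line through \<open>x\<close> in direction
  \<open>v\<close>; the value \<open>x v\<close> does not enter.\<close>

definition mpoly_section :: "'v::finite \<Rightarrow> ('v \<Rightarrow> complex) \<Rightarrow> 'v mpoly \<Rightarrow> complex poly" where
  "mpoly_section v x p = (\<Sum>m\<in>Poly_Mapping.keys p.
     monom (Poly_Mapping.lookup p m * (\<Prod>u\<in>UNIV - {v}. x u ^ Poly_Mapping.lookup m u))
       (Poly_Mapping.lookup m v))"

lemma prod_UNIV_upd:
  fixes x :: "'v::finite \<Rightarrow> complex"
  shows "(\<Prod>u\<in>UNIV. (x(v := s)) u ^ k u) = s ^ k v * (\<Prod>u\<in>UNIV - {v}. x u ^ k u)"
  by (subst prod.remove[of _ v]) auto

lemma poly_mpoly_section: "poly (mpoly_section v x p) s = mpoly_eval p (x(v := s))"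
  unfolding mpoly_section_def mpoly_eval_def prod_UNIV_upd
  by (simp add: poly_sum poly_monom mult_ac)

text \<open>This turns partial derivatives into the derivatives in \<open>tensor_deriv\<close>.
  Comparing values suffices, since a complex polynomial is determined by them.\<close>

lemma pderiv_mpoly_section: "pderiv (mpoly_section v x p) = mpoly_section v x (mpoly_pderiv v p)"
proof -
  have "poly (pderiv (mpoly_section v x p)) s = poly (mpoly_section v x (mpoly_pderiv v p)) s" for s
  proof -
    have "(\<Prod>u\<in>UNIV - {v}. x u ^ Poly_Mapping.lookup (m - Poly_Mapping.single v 1) u) =
        (\<Prod>u\<in>UNIV - {v}. x u ^ Poly_Mapping.lookup m u)" for m
      by (rule prod.cong) (auto simp: lookup_minus lookup_single)
    then show ?thesis
      unfolding poly_mpoly_section mpoly_pderiv_def mpoly_eval_sum mpoly_eval_single prod_UNIV_upd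
      unfolding mpoly_section_def
      by (simp add: higher_pderiv_sum[where n = 1, simplified] pderiv_monom poly_sum poly_monom lookup_minus mult_ac)
  qed
  then show ?thesis by (simp add: poly_eq_poly_eq_iff[symmetric] fun_eq_iff)
qed

text \<open>The degree is bounded in each variable separately, to match the box of exponents in
  \<open>weyl_partial\<close>.\<close>

definition mpoly_degree_le :: "nat \<Rightarrow> 'v mpoly \<Rightarrow> bool" where
  "mpoly_degree_le d p \<longleftrightarrow> (\<forall>m\<in>Poly_Mapping.keys p. \<forall>v. Poly_Mapping.lookup m v \<le> d)"

lemma mpoly_degree_le_exists: "\<exists>d. mpoly_degree_le d (p :: 'v::finite mpoly)"
proof
  show "mpoly_degree_le (\<Sum>m\<in>Poly_Mapping.keys p. \<Sum>v\<in>UNIV. Poly_Mapping.lookup m v) p"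
    unfolding mpoly_degree_le_def
  proof (intro ballI allI)
    fix m v assume "m \<in> Poly_Mapping.keys p"
    then have "(\<Sum>v\<in>UNIV. Poly_Mapping.lookup m v) \<le>
        (\<Sum>m\<in>Poly_Mapping.keys p. \<Sum>v\<in>UNIV. Poly_Mapping.lookup m v)"
      by (intro member_le_sum) auto
    moreover have "Poly_Mapping.lookup m v \<le> (\<Sum>v\<in>UNIV. Poly_Mapping.lookup m v)"
      by (intro member_le_sum) auto
    ultimately show "Poly_Mapping.lookup m v \<le>
        (\<Sum>m\<in>Poly_Mapping.keys p. \<Sum>v\<in>UNIV. Poly_Mapping.lookup m v)"
      by linarith
  qed
qed

lemma mpoly_degree_le_mono: "mpoly_degree_le d p \<Longrightarrow> d \<le> e \<Longrightarrow> mpoly_degree_le e p"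
  by (meson mpoly_degree_le_def order.trans)

lemma mpoly_degree_le_pderiv:
  assumes "mpoly_degree_le d p"
  shows "mpoly_degree_le d (mpoly_pderiv u p)"
  unfolding mpoly_degree_le_def
proof (intro ballI allI)
  fix m v assume "m \<in> Poly_Mapping.keys (mpoly_pderiv u p)"
  then have "m + Poly_Mapping.single u 1 \<in> Poly_Mapping.keys p"
    by (auto simp: in_keys_iff lookup_mpoly_pderiv)
  then have "Poly_Mapping.lookup (m + Poly_Mapping.single u 1) v \<le> d"
    using assms by (simp add: mpoly_degree_le_def)
  then show "Poly_Mapping.lookup m v \<le> d" by (simp add: lookup_add)
qed

lemma degree_mpoly_section: "mpoly_degree_le d p \<Longrightarrow> degree (mpoly_section v x p) \<le> d"
  unfolding mpoly_section_def mpoly_degree_le_def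
  by (intro degree_sum_le) (auto intro: order.trans[OF degree_monom_le])

section \<open>Partial Weyl products, one pair of variables at a time\<close>

definition mpoly_pderivs_on :: "('n \<Rightarrow> 'v) \<Rightarrow> ('n \<Rightarrow> nat) \<Rightarrow> 'n set \<Rightarrow> 'v mpoly \<Rightarrow> 'v mpoly" where
  "mpoly_pderivs_on e \<kappa> S p = Finite_Set.fold (\<lambda>i. mpoly_pderiv (e i) ^^ \<kappa> i) p S"

lemma mpoly_pderivs_on_empty [simp]: "mpoly_pderivs_on e \<kappa> {} p = p"
  by (simp add: mpoly_pderivs_on_def)

lemma mpoly_pderivs_on_insert:
  assumes "finite S" "i \<notin> S"
  shows "mpoly_pderivs_on e \<kappa> (insert i S) p = (mpoly_pderiv (e i) ^^ \<kappa> i) (mpoly_pderivs_on e \<kappa> S p)"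
proof -
  interpret comp_fun_commute "\<lambda>i. mpoly_pderiv (e i) ^^ \<kappa> i"
    by (rule mpoly_pderiv_funpow_commute)
  show ?thesis
    unfolding mpoly_pderivs_on_def using assms by (rule fold_insert)
qed

lemma mpoly_pderivs_on_cong:
  "finite S \<Longrightarrow> (\<And>i. i \<in> S \<Longrightarrow> \<kappa> i = \<kappa>' i) \<Longrightarrow> mpoly_pderivs_on e \<kappa> S p = mpoly_pderivs_on e \<kappa>' S p"
  by (induction S rule: finite_induct) (auto simp: mpoly_pderivs_on_insert)

lemma mpoly_pderivs_on_induct:
  assumes "finite S" "P p" "\<And>v q. P q \<Longrightarrow> P (mpoly_pderiv v q)"
  shows "P (mpoly_pderivs_on e \<kappa> S p)"
proof -
  have "P ((mpoly_pderiv v ^^ k) q)" if "P q" for v k q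
    using that by (induction k) (auto intro: assms(3))
  with assms(1,2) show ?thesis
    by (induction S rule: finite_induct) (auto simp: mpoly_pderivs_on_insert)
qed

text \<open>For \<open>f\<close>, \<open>g\<close> of degree at most \<open>d\<close> in each
  variable, this is the product over \<open>i\<close> in \<open>S\<close> of the operators exp(-
  \<partial>_(e i) \<partial>_(e' i)) applied to f(x) g(y). The points \<open>x\<close> and
  \<open>y\<close> are independent, so a step moves only \<open>x (e i)\<close> and
  \<open>y (e' i)\<close>.\<close>

definition weyl_partial ::
  "nat \<Rightarrow> ('n \<Rightarrow> 'u) \<Rightarrow> ('n \<Rightarrow> 'v) \<Rightarrow> 'n set \<Rightarrow> 'u::finite mpoly \<Rightarrow> 'v::finite mpoly \<Rightarrow>
    ('u \<Rightarrow> complex) \<Rightarrow> ('v \<Rightarrow> complex) \<Rightarrow> complex" where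
  "weyl_partial d e e' S f g x y = (\<Sum>\<kappa>\<in>Pi\<^sub>E S (\<lambda>_. {..d}).
     (\<Prod>i\<in>S. (-1) ^ \<kappa> i / fact (\<kappa> i)) *
     mpoly_eval (mpoly_pderivs_on e \<kappa> S f) x * mpoly_eval (mpoly_pderivs_on e' \<kappa> S g) y)"

text \<open>Splitting off the exponent \<open>k\<close> of the new index exhibits its exponential as
  the outer sum.\<close>

lemma weyl_partial_insert:
  assumes "finite S" "i \<notin> S"
  shows "weyl_partial d e e' (insert i S) f g x y =
    (\<Sum>k\<le>d. (-1) ^ k / fact k * (\<Sum>\<kappa>\<in>Pi\<^sub>E S (\<lambda>_. {..d}). (\<Prod>i\<in>S. (-1) ^ \<kappa> i / fact (\<kappa> i)) *
      mpoly_eval ((mpoly_pderiv (e i) ^^ k) (mpoly_pderivs_on e \<kappa> S f)) x *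
      mpoly_eval ((mpoly_pderiv (e' i) ^^ k) (mpoly_pderivs_on e' \<kappa> S g)) y))"
proof -
  have upd: "mpoly_pderivs_on h (\<kappa>(i := k)) S q = mpoly_pderivs_on h \<kappa> S q"
    for h :: "'a \<Rightarrow> 'z" and \<kappa> k q
    using assms by (intro mpoly_pderivs_on_cong) auto
  have prod: "(\<Prod>j\<in>S. (-1) ^ (if j = i then k else \<kappa> j) / fact (if j = i then k else \<kappa> j)) =
      (\<Prod>j\<in>S. (-1) ^ \<kappa> j / (fact (\<kappa> j) :: complex))" for k \<kappa>
    using assms by (intro prod.cong) auto
  show ?thesis
    unfolding weyl_partial_def PiE_insert_eq
    using assms
    by (subst sum.reindex[OF inj_combinator])
      (auto simp: sum.cartesian_product sum_distrib_left case_prod_unfold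
        mpoly_pderivs_on_insert upd prod mult_ac intro!: sum.cong)
qed

text \<open>Induction on \<open>S\<close> with \<open>x\<close> and \<open>y\<close> arbitrary: the
  hypothesis at all points \<open>x(e i := s)\<close>, \<open>y(e' i := t)\<close> of the upper
  half-plane is stability of a two-variable polynomial, to which \<open>tensor_exp_nonzero\<close>
  applies.\<close>

lemma weyl_partial_nonzero:
  assumes "finite S" "mpoly_degree_le d f" "mpoly_degree_le d g" "stable_poly f" "stable_poly g"
    and "\<And>v. Im (x v) > 0" "\<And>v. Im (y v) > 0"
  shows "weyl_partial d e e' S f g x y \<noteq> 0"
  using assms(1,6,7)
proof (induction S arbitrary: x y rule: finite_induct)
  case empty
  then show ?case using assms(4,5) by (simp add: weyl_partial_def stable_poly_def)
next
  case (insert i S)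
  define I where "I = Pi\<^sub>E S (\<lambda>_. {..d})"
  define C where "C \<kappa> = (\<Prod>i\<in>S. (-1) ^ \<kappa> i / (fact (\<kappa> i) :: complex))" for \<kappa> :: "'a \<Rightarrow> nat"
  have "finite I" unfolding I_def using insert by (intro finite_PiE) auto
  then obtain ks where ks: "set ks = I" "distinct ks"
    using finite_distinct_list by blast
  \<comment> \<open>\<open>T 0\<close> represents the partial product over \<open>S\<close> as a
    polynomial in \<open>s = x (e i)\<close> and \<open>t = y (e' i)\<close>; \<open>T k\<close> is
    its image under \<open>D^k\<close>.\<close>
  define T where "T k = map (\<lambda>\<kappa>.
    (smult (C \<kappa>) (mpoly_section (e i) x ((mpoly_pderiv (e i) ^^ k) (mpoly_pderivs_on e \<kappa> S f))),
     mpoly_section (e' i) y ((mpoly_pderiv (e' i) ^^ k) (mpoly_pderivs_on e' \<kappa> S g)))) ks" for k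
  have T: "(tensor_deriv ^^ k) (T 0) = T k" for k
    by (induction k) (auto simp: T_def tensor_deriv_def pderiv_smult pderiv_mpoly_section)
  have eval: "tensor_eval (T k) s t = (\<Sum>\<kappa>\<in>I. C \<kappa> *
      mpoly_eval ((mpoly_pderiv (e i) ^^ k) (mpoly_pderivs_on e \<kappa> S f)) (x(e i := s)) *
      mpoly_eval ((mpoly_pderiv (e' i) ^^ k) (mpoly_pderivs_on e' \<kappa> S g)) (y(e' i := t)))" for k s t
    using ks by (simp add: tensor_eval_def T_def o_def sum_list_distinct_conv_sum_set poly_mpoly_section)
  have "tensor_eval (T 0) s t = weyl_partial d e e' S f g (x(e i := s)) (y(e' i := t))" for s t
    by (simp add: eval weyl_partial_def I_def C_def)
  then have "tensor_stable (T 0)"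
    unfolding tensor_stable_def using insert.IH insert.prems by simp
  moreover have "mpoly_degree_le d (mpoly_pderivs_on e \<kappa> S f)"
    "mpoly_degree_le d (mpoly_pderivs_on e' \<kappa> S g)" for \<kappa>
    using assms(2,3) mpoly_degree_le_pderiv
    by (auto intro!: mpoly_pderivs_on_induct[where P = "mpoly_degree_le d"] \<open>finite S\<close>)
  then have "tensor_degree_le d (T 0)"
    by (auto simp: tensor_degree_le_def T_def
        intro: order.trans[OF degree_smult_le] degree_mpoly_section)
  ultimately have "(\<Sum>k\<le>d. (-1) ^ k / fact k *
      tensor_eval ((tensor_deriv ^^ k) (T 0)) (x (e i)) (y (e' i))) \<noteq> 0"
    using insert.prems by (intro tensor_exp_nonzero)
  then show ?case
    by (simp add: weyl_partial_insert insert T eval I_def C_def)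
qed

section \<open>Stability of the Weyl product\<close>

text \<open>Outside the box some \<open>\<kappa> i\<close> exceeds the degree of \<open>f\<close> in
  \<open>Inl i\<close>, so the derivative of \<open>f\<close> vanishes.\<close>

lemma weyl_product_eq_sum:
  assumes "mpoly_degree_le d f"
  shows "f \<star> g = (\<Sum>\<kappa>\<in>Pi\<^sub>E UNIV (\<lambda>_. {..d}). weyl_term f g \<kappa>)"
  unfolding weyl_product_def
proof (rule Sum_any.expand_superset)
  show "finite (Pi\<^sub>E UNIV (\<lambda>_. {..d}) :: ('a \<Rightarrow> nat) set)" by (rule finite_PiE) auto
  have "\<kappa> i \<le> d" if "weyl_term f g \<kappa> \<noteq> 0" for \<kappa> i
  proof (rule ccontr)
    assume "\<not> \<kappa> i \<le> d"
    then have "mpoly_pderivs Inl \<kappa> f = 0"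
      using assms by (intro mpoly_pderivs_eq_0[where i = i])
        (meson mpoly_degree_le_def le_less_trans not_le)
    with that show False by (simp add: weyl_term_def)
  qed
  then show "{\<kappa>. weyl_term f g \<kappa> \<noteq> 0} \<subseteq> Pi\<^sub>E UNIV (\<lambda>_. {..d})" by auto
qed

lemma mpoly_pderivs_eq_on: "mpoly_pderivs e \<kappa> p = mpoly_pderivs_on e \<kappa> UNIV p"
  by (simp add: mpoly_pderivs_def mpoly_pderivs_on_def)

text \<open>The Weyl product is the diagonal \<open>x = y\<close> of the full partial
  product.\<close>

lemma mpoly_eval_weyl_product:
  assumes "mpoly_degree_le d f"
  shows "mpoly_eval (f \<star> g) x = weyl_partial d Inl Inr UNIV f g x x"
  unfolding weyl_product_eq_sum[OF assms] weyl_partial_def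
  by (simp add: mpoly_eval_sum weyl_term_def mpoly_eval_mult mpoly_eval_const mpoly_pderivs_eq_on
      prod_dividef power_sum)

lemma stable_weyl_product:
  assumes "stable_poly f" "stable_poly g"
  shows "stable_poly (f \<star> g)"
proof -
  obtain d\<^sub>1 d\<^sub>2 where "mpoly_degree_le d\<^sub>1 f" "mpoly_degree_le d\<^sub>2 g"
    using mpoly_degree_le_exists by metis
  then have "mpoly_degree_le (max d\<^sub>1 d\<^sub>2) f" "mpoly_degree_le (max d\<^sub>1 d\<^sub>2) g"
    by (auto elim: mpoly_degree_le_mono)
  then show ?thesis
    unfolding stable_poly_def[of "f \<star> g"] using assms
    by (simp add: mpoly_eval_weyl_product weyl_partial_nonzero)
qed

section \<open>Real coefficients\<close>

definition real_coeffs :: "'v mpoly \<Rightarrow> bool" where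
  "real_coeffs p \<longleftrightarrow> (\<forall>m. Poly_Mapping.lookup p m \<in> \<real>)"

lemma real_coeffs_mult: "real_coeffs p \<Longrightarrow> real_coeffs q \<Longrightarrow> real_coeffs (p * q)"
  by (auto simp: real_coeffs_def poly_mapping_mult_eq_sum_single lookup_sum lookup_single when_def)

lemma real_coeffs_pderiv: "real_coeffs p \<Longrightarrow> real_coeffs (mpoly_pderiv v p)"
  by (auto simp: real_coeffs_def lookup_mpoly_pderiv intro!: Reals_mult Reals_add)

lemma real_coeffs_weyl_product:
  assumes "real_coeffs f" "real_coeffs g"
  shows "real_coeffs (f \<star> g)"
proof -
  have "real_coeffs (mpoly_pderivs Inl \<kappa> f)" "real_coeffs (mpoly_pderivs Inr \<kappa> g)" for \<kappa>
    unfolding mpoly_pderivs_eq_on using assms real_coeffs_pderiv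
    by (auto intro!: mpoly_pderivs_on_induct[where P = real_coeffs])
  moreover have "(fact n :: complex) \<in> \<real>" for n
    by (metis Reals_of_nat of_nat_fact)
  then have "real_coeffs
      (mpoly_const ((-1) ^ (\<Sum>i\<in>UNIV. \<kappa> i) / (\<Prod>i\<in>UNIV. fact (\<kappa> i))) :: ('a + 'a) mpoly)"
    for \<kappa> :: "'a \<Rightarrow> nat"
    by (auto simp: real_coeffs_def mpoly_const_def lookup_single when_def
        intro!: Reals_divide Reals_power prod_in_Reals)
  ultimately have "real_coeffs (weyl_term f g \<kappa>)" for \<kappa>
    unfolding weyl_term_def by (intro real_coeffs_mult)
  moreover obtain d where "mpoly_degree_le d f"
    using mpoly_degree_le_exists by blast
  ultimately show ?thesis
    by (auto simp: real_coeffs_def weyl_product_eq_sum lookup_sum intro!: sum_in_Reals)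
qed

theorem theorem4p6:
  fixes f g :: "('n::finite + 'n) mpoly"
  shows "(stable_poly f \<and> stable_poly g \<longrightarrow> stable_poly (f \<star> g)) \<and>
         (real_stable_poly f \<and> real_stable_poly g \<longrightarrow> real_stable_poly (f \<star> g))"
  using stable_weyl_product[of f g] real_coeffs_weyl_product[of f g]
  by (auto simp: real_stable_poly_def real_coeffs_def)

end
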